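(* For every integer $k\ge 2$ there exists a sequence of real numbers $(a_{k,r})_{r\ge 1}$, depending only on $k$, such that for every integer $l\ge 2$ there exists a real constant $C_{k,l}>1$ with $$g_{k,l}(n)\sim C_{k,l}^{k^n}\, n^{\frac{1}{k-1}}\left(1+\sum_{r=1}^\infty \frac{a_{k,r}}{n^r}\right)\quad (n\to\infty)$$ in the sense of asymptotic expansions, that is, for every integer $R\ge 0$, $$g_{k,l}(n)-C_{k,l}^{k^n}\, n^{\frac{1}{k-1}}\left(1+\sum_{r=1}^{R}\frac{a_{k,r}}{n^r}\right)=O\!\left(C_{k,l}^{k^n}\,n^{\frac{1}{k-1}}\,n^{-(R+1)}\right)\quad (n\to\infty).$$
   Context: For integers $k,l\ge 2$, the $(k,l)$-Göbel sequence $(g_{k,l}(n))_{n\ge 1}$ of rational numbers is defined by $g_{k,l}(1)=l$ and the recursion $(n+1)\,g_{k,l}(n+1)=g_{k,l}(n)\,\bigl(n+g_{k,l}(n)^{k-1}\bigr)$ for $n\ge 1$. Here $C_{k,l}^{k^n}$ means $C_{k,l}$ raised to the power $k^n$. Implied constants in $O(\cdot)$ may depend on $k,l,R$. *)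

theory Defs
  imports Complex_Main "HOL-Library.Landau_Symbols"
begin

text \<open>
  The sequence starts at index \<open>1\<close>; the value at \<open>0\<close> is a dummy which nothing else depends on.
  The last equation is \<open>(n + 1) g(n + 1) = g(n) (n + g(n)^(k - 1))\<close>, shifted by one and
  solved for the new term.
\<close>
fun goebel :: "nat \<Rightarrow> nat \<Rightarrow> nat \<Rightarrow> rat" where
  "goebel k l 0 = 0"
| "goebel k l (Suc 0) = of_nat l"
| "goebel k l (Suc (Suc n)) =
     goebel k l (Suc n) * (of_nat (Suc n) + goebel k l (Suc n) ^ (k - 1)) / of_nat (Suc (Suc n))"

lemma goebel_1: "goebel k l 1 = of_nat l"
  by simp

lemma goebel_rec:
  assumes "n \<ge> 1"
  shows "of_nat (n + 1) * goebel k l (n + 1)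
           = goebel k l n * (of_nat n + goebel k l n ^ (k - 1))"
proof -
  obtain m where n: "n = Suc m"
    using assms by (cases n) auto
  have "(of_nat (Suc (Suc m)) :: rat) \<noteq> 0"
    using of_nat_neq_0 by blast
  then show ?thesis
    unfolding n by (simp del: of_nat_Suc)
qed

end

theory Submission
  imports Defs "HOL-Computational_Algebra.Formal_Power_Series" "HOL-Real_Asymp.Real_Asymp"
begin

text \<open>
  Taking logarithms turns the recursion into
  \<open>ln g(n + 1) = k ln g(n) - ln (n + 1) + e(n)\<close> with \<open>e(n) = ln (1 + n / g(n)^(k - 1))\<close>.
  Dividing by \<open>k^(n + 1)\<close> and telescoping, \<open>ln g(n) / k^n\<close> converges to some \<open>L = ln C\<close>, and
  \<open>ln g(n) - k^n L - ln n / (k - 1) = (\<Sum>j\<ge>1. (ln (1 + j / n) - e(n + j - 1)) / k^j)\<close>.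
  Since \<open>g\<close> grows doubly exponentially, \<open>e\<close> is smaller than every power of \<open>1 / n\<close>, so
  Taylor expansion of \<open>ln (1 + j / n)\<close> gives an asymptotic expansion of the right-hand side whose
  coefficients depend on \<open>k\<close> only. Exponentiating it yields the claim. Formal power series merely
  keep track of the coefficients: the series involved diverge.
\<close>

section \<open>Asymptotic expansions in powers of 1/n: products and powers\<close>

definition has_asymp_expansion :: "(nat \<Rightarrow> real) \<Rightarrow> real fps \<Rightarrow> bool" where
  "has_asymp_expansion f F \<longleftrightarrow>
     (\<forall>R. (\<lambda>n. f n - (\<Sum>r\<le>R. fps_nth F r / real n ^ r)) \<in> O(\<lambda>n. 1 / real n ^ Suc R))"

lemma has_asymp_expansionI:
  assumes "\<And>R. (\<lambda>n. f n - (\<Sum>r\<le>R. fps_nth F r / real n ^ r)) \<in> O(\<lambda>n. 1 / real n ^ Suc R)"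
  shows "has_asymp_expansion f F"
  using assms by (simp add: has_asymp_expansion_def)

lemma has_asymp_expansionD:
  assumes "has_asymp_expansion f F"
  shows "(\<lambda>n. f n - (\<Sum>r\<le>R. fps_nth F r / real n ^ r)) \<in> O(\<lambda>n. 1 / real n ^ Suc R)"
  using assms by (simp add: has_asymp_expansion_def)

lemma inverse_power_bigo:
  assumes "m \<le> i"
  shows "(\<lambda>n. c / real n ^ i) \<in> O(\<lambda>n. 1 / real n ^ m)"
proof (rule bigoI)
  show "eventually (\<lambda>n. norm (c / real n ^ i) \<le> \<bar>c\<bar> * norm (1 / real n ^ m)) sequentially"
    using eventually_gt_at_top[of 0]
  proof eventually_elim
    case (elim n)
    have "real n ^ m \<le> real n ^ i"
      using elim assms by (intro power_increasing) auto
    then show ?case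
      using elim by (simp add: frac_le)
  qed
qed

lemma asymp_partial_sum_bounded:
  "(\<lambda>n. \<Sum>r\<le>R. fps_nth F r / real n ^ r) \<in> O(\<lambda>n. 1)"
  using inverse_power_bigo[of 0] by (intro big_sum_in_bigo) auto

lemma has_asymp_expansion_bounded:
  assumes "has_asymp_expansion f F"
  shows "f \<in> O(\<lambda>n. 1)"
proof -
  have "(\<lambda>n. f n - (\<Sum>r\<le>0. fps_nth F r / real n ^ r)) \<in> O(\<lambda>n. 1 / real n ^ Suc 0)"
    using has_asymp_expansionD[OF assms, of 0] .
  also have "(\<lambda>n. 1 / real n ^ Suc 0) \<in> O(\<lambda>n. 1)"
    using inverse_power_bigo[of 0 "Suc 0" 1] by simp
  finally have "(\<lambda>n. (f n - (\<Sum>r\<le>0. fps_nth F r / real n ^ r)) + (\<Sum>r\<le>0. fps_nth F r / real n ^ r)) \<in> O(\<lambda>n. 1)"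
    using asymp_partial_sum_bounded by (rule sum_in_bigo)
  then show ?thesis by simp
qed

text \<open>With \<open>P\<close> the truncation at order \<open>R\<close>, the error splits as (f -
  P F) g + P F (g - P G) + (P F P G - P (F G)). The first two summands are a small factor times a
  bounded one; the last contains only products of total degree above \<open>R\<close>, those indexed
  by \<open>J\<close>.\<close>

lemma has_asymp_expansion_mult:
  assumes f: "has_asymp_expansion f F" and g: "has_asymp_expansion g G"
  shows "has_asymp_expansion (\<lambda>n. f n * g n) (F * G)"
proof (rule has_asymp_expansionI)
  fix R
  define P where "P H n = (\<Sum>r\<le>R. fps_nth H r / real n ^ r)" for H :: "real fps" and n
  let ?O = "O(\<lambda>n. 1 / real n ^ Suc R)"
  define J where "J = {(i, j). i \<le> R \<and> j \<le> R \<and> R < i + j}"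
  define I where "I = {(i, j). i + j \<le> R}"
  have IJ: "{..R} \<times> {..R} = I \<union> J" "I \<inter> J = {}"
    by (auto simp: I_def J_def)
  then have fin: "finite I" "finite J"
    by (metis finite_SigmaI finite_Un finite_atMost)+
  have "P F n * P G n - P (F * G) n = (\<Sum>(i, j)\<in>J. fps_nth F i * fps_nth G j / real n ^ (i + j))" for n
  proof -
    have "P F n * P G n = (\<Sum>(i, j)\<in>{..R} \<times> {..R}. fps_nth F i * fps_nth G j / real n ^ (i + j))"
      by (simp add: P_def sum_product sum.cartesian_product power_add)
    also have "\<dots> = (\<Sum>(i, j)\<in>I. fps_nth F i * fps_nth G j / real n ^ (i + j))
        + (\<Sum>(i, j)\<in>J. fps_nth F i * fps_nth G j / real n ^ (i + j))"
      unfolding IJ(1) using fin IJ(2) by (rule sum.union_disjoint)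
    also have "(\<Sum>(i, j)\<in>I. fps_nth F i * fps_nth G j / real n ^ (i + j))
        = (\<Sum>r\<le>R. \<Sum>i\<le>r. fps_nth F i * fps_nth G (r - i) / real n ^ (i + (r - i)))"
      unfolding I_def by (rule sum.triangle_reindex_eq)
    also have "\<dots> = P (F * G) n"
      by (simp add: P_def fps_mult_nth sum_divide_distrib atLeast0AtMost)
    finally show ?thesis by simp
  qed
  moreover have "(\<lambda>n. \<Sum>(i, j)\<in>J. fps_nth F i * fps_nth G j / real n ^ (i + j)) \<in> ?O"
    by (rule big_sum_in_bigo) (auto simp: J_def simp del: power_Suc intro!: inverse_power_bigo)
  ultimately have PP: "(\<lambda>n. P F n * P G n - P (F * G) n) \<in> ?O"
    by simp
  have "(\<lambda>n. (f n - P F n) * g n) \<in> O(\<lambda>n. 1 / real n ^ Suc R * 1)"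
    using has_asymp_expansionD[OF f, of R] has_asymp_expansion_bounded[OF g]
    unfolding P_def by (rule landau_o.big.mult)
  moreover have "(\<lambda>n. P F n * (g n - P G n)) \<in> O(\<lambda>n. 1 * (1 / real n ^ Suc R))"
    using asymp_partial_sum_bounded has_asymp_expansionD[OF g, of R]
    unfolding P_def by (rule landau_o.big.mult)
  ultimately have "(\<lambda>n. (f n - P F n) * g n + P F n * (g n - P G n) + (P F n * P G n - P (F * G) n)) \<in> ?O"
    using PP by (intro sum_in_bigo(1)) simp_all
  moreover have "(\<lambda>n. (f n - P F n) * g n + P F n * (g n - P G n) + (P F n * P G n - P (F * G) n))
      = (\<lambda>n. f n * g n - P (F * G) n)"
    by (simp add: algebra_simps)
  ultimately show "(\<lambda>n. f n * g n - (\<Sum>r\<le>R. fps_nth (F * G) r / real n ^ r)) \<in> ?O"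
    by (simp only: P_def)
qed

lemma has_asymp_expansion_const: "has_asymp_expansion (\<lambda>_. c) (fps_const c)"
proof (rule has_asymp_expansionI)
  fix R
  have "(\<Sum>r\<le>R. fps_nth (fps_const c) r / real n ^ r) = c" for n
    by (subst sum.remove[of _ 0]) auto
  then show "(\<lambda>n. c - (\<Sum>r\<le>R. fps_nth (fps_const c) r / real n ^ r)) \<in> O(\<lambda>n. 1 / real n ^ Suc R)"
    by simp
qed

lemma has_asymp_expansion_power:
  assumes "has_asymp_expansion f F"
  shows "has_asymp_expansion (\<lambda>n. f n ^ m) (F ^ m)"
proof (induction m)
  case 0
  show ?case using has_asymp_expansion_const[of 1] by simp
next
  case (Suc m)
  then show ?case using has_asymp_expansion_mult[OF assms Suc] by simp
qed

lemma has_asymp_expansion_bigo: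
  assumes f: "has_asymp_expansion f F" and F0: "fps_nth F 0 = 0"
  shows "f \<in> O(\<lambda>n. 1 / real n)"
  using has_asymp_expansionD[OF f, of 0] F0 by simp

section \<open>Exponentials of asymptotic expansions\<close>

text \<open>Lagrange remainder: the intermediate point satisfies |t| <= |f n| <= B eventually, so
  \<open>exp B\<close> serves as the implied constant.\<close>

lemma exp_taylor_bigo:
  fixes f :: "nat \<Rightarrow> real"
  assumes "f \<in> O(\<lambda>n. 1)"
  shows "(\<lambda>n. exp (f n) - (\<Sum>m\<le>R. f n ^ m / fact m)) \<in> O(\<lambda>n. f n ^ Suc R)"
proof -
  obtain B where B: "eventually (\<lambda>n. norm (f n) \<le> B * norm (1::real)) sequentially"
    using assms by (rule landau_o.bigE)
  show ?thesis
  proof (rule bigoI)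
    show "eventually (\<lambda>n. norm (exp (f n) - (\<Sum>m\<le>R. f n ^ m / fact m)) \<le> exp B * norm (f n ^ Suc R)) sequentially"
      using B
    proof eventually_elim
      case (elim n)
      obtain t where t: "\<bar>t\<bar> \<le> \<bar>f n\<bar>"
        "exp (f n) = (\<Sum>m<Suc R. f n ^ m / fact m) + exp t / fact (Suc R) * f n ^ Suc R"
        using Maclaurin_exp_le by blast
      have "exp t / fact (Suc R) \<le> exp t / 1"
        by (intro divide_left_mono) (auto simp del: fact_Suc)
      also have "\<dots> \<le> exp B"
        using t(1) elim by simp
      finally have "exp t / fact (Suc R) * \<bar>f n ^ Suc R\<bar> \<le> exp B * \<bar>f n ^ Suc R\<bar>"
        by (intro mult_right_mono) auto
      then show ?case
        using t(2) by (simp add: lessThan_Suc_atMost abs_mult del: fact_Suc power_Suc)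
    qed
  qed
qed

text \<open>The vanishing constant term enters twice: f^(R+1) is O(n^-(R+1)), so the exponential
  series may be cut after order \<open>R\<close>, and \<open>F ^ m\<close> starts at degree m, so
  these same terms determine all coefficients of the composition up to \<open>R\<close>.\<close>

lemma has_asymp_expansion_exp:
  assumes f: "has_asymp_expansion f F" and F0: "fps_nth F 0 = 0"
  shows "has_asymp_expansion (\<lambda>n. exp (f n)) (fps_exp 1 oo F)"
proof (rule has_asymp_expansionI)
  fix R
  let ?O = "O(\<lambda>n. 1 / real n ^ Suc R)"
  have "(\<lambda>n. exp (f n) - (\<Sum>m\<le>R. f n ^ m / fact m)) \<in> O(\<lambda>n. f n ^ Suc R)"
    by (rule exp_taylor_bigo[OF has_asymp_expansion_bounded[OF f]])
  also have "(\<lambda>n. f n ^ Suc R) \<in> O(\<lambda>n. (1 / real n) ^ Suc R)"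
    by (rule landau_o.big_power[OF has_asymp_expansion_bigo[OF f F0]])
  also have "(\<lambda>n. (1 / real n) ^ Suc R) = (\<lambda>n. 1 / real n ^ Suc R)"
    by (simp add: power_divide)
  finally have 1: "(\<lambda>n. exp (f n) - (\<Sum>m\<le>R. f n ^ m / fact m)) \<in> ?O" .
  have 2: "(\<lambda>n. \<Sum>m\<le>R. 1 / fact m * (f n ^ m - (\<Sum>r\<le>R. fps_nth (F ^ m) r / real n ^ r))) \<in> ?O"
    by (intro big_sum_in_bigo landau_o.big.cmult_in_iff[THEN iffD2] impI disjI2
        has_asymp_expansionD has_asymp_expansion_power f) auto
  \<comment> \<open>Raising the upper limit for m from r to \<open>R\<close> adds only zeros; a
    range that does not depend on r permits the exchange of sums below.\<close>
  have coeff: "fps_nth (fps_exp 1 oo F) r = (\<Sum>m\<le>R. fps_nth (F ^ m) r / fact m)" if "r \<le> R" for r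
  proof -
    have "(\<Sum>m\<le>R. fps_nth (F ^ m) r / fact m) = (\<Sum>m\<le>r. fps_nth (F ^ m) r / fact m)"
      using that F0 by (intro sum.mono_neutral_right) (auto intro: startsby_zero_power_prefix[rule_format])
    then show ?thesis
      by (simp add: fps_compose_nth atLeast0AtMost)
  qed
  have "(\<Sum>r\<le>R. fps_nth (fps_exp 1 oo F) r / real n ^ r)
      = (\<Sum>m\<le>R. 1 / fact m * (\<Sum>r\<le>R. fps_nth (F ^ m) r / real n ^ r))" for n
  proof -
    have "(\<Sum>r\<le>R. fps_nth (fps_exp 1 oo F) r / real n ^ r)
        = (\<Sum>r\<le>R. \<Sum>m\<le>R. 1 / fact m * (fps_nth (F ^ m) r / real n ^ r))"
      by (rule sum.cong) (auto simp: coeff sum_divide_distrib)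
    also have "\<dots> = (\<Sum>m\<le>R. \<Sum>r\<le>R. 1 / fact m * (fps_nth (F ^ m) r / real n ^ r))"
      by (rule sum.swap)
    finally show ?thesis
      by (simp only: sum_distrib_left)
  qed
  then have eq: "exp (f n) - (\<Sum>r\<le>R. fps_nth (fps_exp 1 oo F) r / real n ^ r)
      = (exp (f n) - (\<Sum>m\<le>R. f n ^ m / fact m))
        + (\<Sum>m\<le>R. 1 / fact m * (f n ^ m - (\<Sum>r\<le>R. fps_nth (F ^ m) r / real n ^ r)))" for n
    by (simp add: right_diff_distrib sum_subtractf)
  show "(\<lambda>n. exp (f n) - (\<Sum>r\<le>R. fps_nth (fps_exp 1 oo F) r / real n ^ r)) \<in> ?O"
    unfolding eq by (rule sum_in_bigo(1)[OF 1 2])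
qed

section \<open>The logarithm's Taylor remainder and series weighted by powers of k\<close>

text \<open>The derivative of the remainder is that of a geometric series, (-t)^R / (1 + t), so the
  mean value theorem gives the bound. It holds for every x >= 0, even where the Taylor series
  diverges; this matters because x = j/n is used for all j, also j > n.\<close>

lemma ln_taylor_bound:
  fixes x :: real
  assumes "x \<ge> 0"
  shows "\<bar>ln (1 + x) - (\<Sum>r\<le>R. (-1) ^ Suc r / real r * x ^ r)\<bar> \<le> x ^ Suc R"
proof (cases "x = 0")
  case True
  then show ?thesis by (simp add: power_0_left sum.neutral)
next
  case False
  then have x: "x > 0" using assms by simp
  define F where "F t = ln (1 + t) - (\<Sum>r\<le>R. (-1) ^ Suc r / real r * t ^ r)" for t :: real
  define F' where "F' t = 1 / (1 + t) - (\<Sum>r<R. (- t) ^ r)" for t :: real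
  \<comment> \<open>The r = 0 summand is 0 because its coefficient divides by 0, so the index can be
    shifted.\<close>
  have S: "(\<Sum>r\<le>R. (-1) ^ Suc r / real r * t ^ r) = (\<Sum>r<R. (-1) ^ r / real (Suc r) * t ^ Suc r)" for t :: real
    unfolding lessThan_Suc_atMost[symmetric] by (subst sum.lessThan_Suc_shift) simp
  have D: "(F has_real_derivative F' t) (at t)" if "t \<ge> 0" for t
  proof -
    have "((\<lambda>t. (-1) ^ r / real (Suc r) * t ^ Suc r) has_real_derivative (- t) ^ r) (at t)" for r
      by (rule derivative_eq_intros refl | simp add: power_minus[of t r] field_simps)+
    then show ?thesis
      unfolding F_def F'_def S using that
      by (auto intro!: derivative_eq_intros sum.cong simp: power_minus[of t] simp del: power_Suc of_nat_Suc)
  qed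
  obtain z where z: "0 < z" "z < x" "F x - F 0 = (x - 0) * F' z"
    using MVT2[OF x, of F F'] D by auto
  have "F' z = (- z) ^ R / (1 + z)"
    using z(1) sum_gp_strict[of "- z" R] by (simp add: F'_def field_simps)
  then have "\<bar>F' z\<bar> = z ^ R / (1 + z)"
    using z(1) by (simp add: power_abs)
  also have "\<dots> \<le> z ^ R / 1"
    using z(1) by (intro divide_left_mono) auto
  also have "\<dots> \<le> x ^ R"
    using z by (simp add: power_mono)
  finally have "\<bar>F x - F 0\<bar> \<le> x * x ^ R"
    using z(3) x by (simp add: abs_mult)
  moreover have "F 0 = 0"
    unfolding F_def S by simp
  ultimately show ?thesis
    by (simp add: F_def)
qed

text \<open>The base 3/2 lies below 2 <= k, leaving the ratio 3/4 for a comparison with powers of k;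
  it is also the base in the lower bounds for the sequence.\<close>

lemma power_le_exponential:
  obtains K :: real where "K > 0" "\<And>n. real n ^ r \<le> K * (3/2) ^ n"
proof -
  have "(\<lambda>n. real n ^ r / (3/2) ^ n) \<longlonglongrightarrow> 0"
    by real_asymp
  then have "Bseq (\<lambda>n. real n ^ r / (3/2) ^ n)"
    by (intro convergent_imp_Bseq convergentI)
  then obtain K where "K > 0" "\<And>n. norm (real n ^ r / (3/2) ^ n) \<le> K"
    by (rule BseqE) blast
  then show thesis
    by (intro that[of K]) (auto simp: field_simps)
qed

lemma summable_power_over_exp:
  assumes "k \<ge> (2::nat)"
  shows "summable (\<lambda>j. real (Suc j) ^ r / real k ^ Suc j)"
proof -
  obtain K :: real where K: "K > 0" "\<And>n. real n ^ r \<le> K * (3/2) ^ n"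
    using power_le_exponential[of r] by blast
  show ?thesis
  proof (rule summable_comparison_test')
    show "summable (\<lambda>j. K * (3/4) * (3/4::real) ^ j)"
      by (intro summable_mult summable_geometric) simp
    fix j :: nat
    have "real (Suc j) ^ r / real k ^ Suc j \<le> K * (3/2) ^ Suc j / 2 ^ Suc j"
      using K assms by (intro frac_le power_mono) (auto simp del: of_nat_Suc power_Suc)
    also have "\<dots> = K * (3/4) * (3/4) ^ j"
      by (simp add: power_divide flip: power_mult_distrib)
    finally show "norm (real (Suc j) ^ r / real k ^ Suc j) \<le> K * (3/4) * (3/4) ^ j"
      by simp
  qed
qed

text \<open>Origin of the exponent 1/(k-1): after writing ln (n + j) = ln n + ln (1 + j/n), this is
  the total weight of ln n.\<close>

lemma sums_inverse_powers:
  assumes "k \<ge> (2::nat)"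
  shows "(\<lambda>j. 1 / real k ^ Suc j) sums (1 / (real k - 1))"
proof -
  have "(\<lambda>j. (1 / real k) * (1 / real k) ^ j) sums ((1 / real k) * (1 / (1 - 1 / real k)))"
    using assms by (intro sums_mult geometric_sums) auto
  then show ?thesis
    using assms by (simp add: power_divide field_simps)
qed

section \<open>The sequence over the reals and its growth\<close>

definition goebel_real :: "nat \<Rightarrow> nat \<Rightarrow> nat \<Rightarrow> real" where
  "goebel_real k l n = of_rat (goebel k l n)"

definition goebel_err :: "nat \<Rightarrow> nat \<Rightarrow> nat \<Rightarrow> real" where
  "goebel_err k l n = ln (1 + real n / goebel_real k l n ^ (k - 1))"

text \<open>The coefficient for \<open>r = 0\<close> is \<open>0\<close> because \<open>x / 0 = 0\<close>.\<close>

definition goebel_coeffs :: "nat \<Rightarrow> real fps" where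
  "goebel_coeffs k =
     Abs_fps (\<lambda>r. (-1) ^ Suc r / real r * (\<Sum>j. real (Suc j) ^ r / real k ^ Suc j))"

lemma goebel_real_1 [simp]: "goebel_real k l (Suc 0) = real l"
  by (simp add: goebel_real_def)

lemma goebel_real_Suc:
  assumes "n \<ge> 1"
  shows "goebel_real k l (Suc n)
    = goebel_real k l n * (real n + goebel_real k l n ^ (k - 1)) / real (Suc n)"
proof -
  obtain m where n: "n = Suc m"
    using assms by (cases n) auto
  show ?thesis
    unfolding n goebel_real_def
    by (simp add: of_rat_add of_rat_mult of_rat_divide of_rat_power del: of_nat_Suc)
qed

context
  fixes k l :: nat
  assumes k: "k \<ge> 2" and l: "l \<ge> 2"
begin

lemma goebel_real_ge: "n \<ge> 1 \<Longrightarrow> goebel_real k l n \<ge> 2"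
proof (induction n rule: dec_induct)
  case base
  then show ?case using l by simp
next
  case (step n)
  have "goebel_real k l n ^ 1 \<le> goebel_real k l n ^ (k - 1)"
    using step k by (intro power_increasing) auto
  then have "2 * real (Suc n) \<le> goebel_real k l n * (real n + goebel_real k l n ^ (k - 1))"
    using step by (intro mult_mono) auto
  then show ?case
    using step(1) by (simp add: goebel_real_Suc field_simps)
qed

lemma goebel_real_pos: "n \<ge> 1 \<Longrightarrow> goebel_real k l n > 0"
  using goebel_real_ge[of n] by linarith

lemma goebel_real_Suc_ge:
  assumes n: "n \<ge> 1"
  shows "goebel_real k l (Suc n) \<ge> goebel_real k l n ^ k / real (Suc n)"
proof -
  have "goebel_real k l n ^ k = goebel_real k l n * goebel_real k l n ^ (k - 1)"
    using k by (simp flip: power_Suc)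
  also have "\<dots> \<le> goebel_real k l n * (real n + goebel_real k l n ^ (k - 1))"
    using goebel_real_pos[OF n] by (intro mult_left_mono) auto
  finally show ?thesis
    unfolding goebel_real_Suc[OF n] by (intro divide_right_mono) auto
qed

text \<open>Weakening g^(k-1) to g reduces to the recursion for k = 2, so numerical lower bounds can
  be propagated uniformly in k.\<close>

lemma goebel_real_Suc_ge_of_ge:
  assumes n: "n \<ge> 1" and c: "goebel_real k l n \<ge> c" "c \<ge> 0"
  shows "goebel_real k l (Suc n) \<ge> c * (real n + c) / real (Suc n)"
proof -
  have "goebel_real k l n ^ 1 \<le> goebel_real k l n ^ (k - 1)"
    using goebel_real_ge[OF n] k by (intro power_increasing) auto
  then have "c \<le> goebel_real k l n ^ (k - 1)"
    using c by simp
  then have "c * (real n + c) \<le> goebel_real k l n * (real n + goebel_real k l n ^ (k - 1))"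
    using c by (intro mult_mono) auto
  then show ?thesis
    unfolding goebel_real_Suc[OF n] by (intro divide_right_mono) auto
qed

text \<open>The bounds 2, 3, 5, 10 are the exact values for k = l = 2. Index 4 is the first at which
  they exceed n + 2, and 10 >= 6 * 3/2 starts the induction that follows.\<close>

lemma goebel_real_4: "goebel_real k l 4 \<ge> 10"
proof -
  have "goebel_real k l (Suc 0) \<ge> 2" using l by simp
  then have "goebel_real k l 2 \<ge> 3"
    using goebel_real_Suc_ge_of_ge[of 1 2] by (simp add: numeral_2_eq_2)
  then have "goebel_real k l 3 \<ge> 5"
    using goebel_real_Suc_ge_of_ge[of 2 3] by (simp add: eval_nat_numeral)
  then show ?thesis
    using goebel_real_Suc_ge_of_ge[of 3 5] by (simp add: eval_nat_numeral)
qed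

text \<open>The factor \<open>n + 2\<close> absorbs the division by \<open>n + 1\<close>, as \<open>(n + 2)\<^sup>2 \<ge> (n + 1) (n + 3)\<close>.\<close>

lemma goebel_real_ge_double_exp:
  "goebel_real k l (m + 4) \<ge> (real m + 6) * (3/2) ^ (k ^ m)"
proof (induction m)
  case 0
  then show ?case using goebel_real_4 by simp
next
  case (Suc m)
  have "(real m + 7) * (real m + 5) \<le> (real m + 6) ^ 2"
    by (simp add: power2_eq_square algebra_simps)
  also have "\<dots> \<le> (real m + 6) ^ k"
    using k by (intro power_increasing) auto
  finally have "(real m + 7) * (real m + 5) * (3/2) ^ (k ^ Suc m)
      \<le> (real m + 6) ^ k * (3/2) ^ (k ^ Suc m)"
    by (intro mult_right_mono) auto
  also have "\<dots> = ((real m + 6) * (3/2) ^ (k ^ m)) ^ k"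
    by (simp add: power_mult_distrib mult.commute flip: power_mult)
  also have "\<dots> \<le> goebel_real k l (m + 4) ^ k"
    using Suc by (intro power_mono) auto
  finally have "(real m + 7) * (3/2) ^ (k ^ Suc m) \<le> goebel_real k l (m + 4) ^ k / real (Suc (m + 4))"
    by (simp add: field_simps)
  also have "\<dots> \<le> goebel_real k l (Suc (m + 4))"
    by (rule goebel_real_Suc_ge) simp
  finally show ?case by (simp add: algebra_simps)
qed

text \<open>Since m <= k^m, the double exponential bound yields a plain exponential one, enough to
  beat any power of n. The divisor (3/2)^4 accounts for the index shift and makes the bound trivial
  for n < 4.\<close>

lemma goebel_real_ge_exp:
  assumes "n \<ge> 1"
  shows "goebel_real k l n \<ge> (3/2) ^ n / (3/2) ^ 4"
proof (cases "n < 4")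
  case True
  then have "(3/2::real) ^ n \<le> (3/2) ^ 4"
    by (intro power_increasing) auto
  then have "(3/2::real) ^ n / (3/2) ^ 4 \<le> 1" by simp
  then show ?thesis using goebel_real_ge[OF assms] by linarith
next
  case False
  then obtain m where n: "n = m + 4"
    by (metis add.commute le_Suc_ex not_less)
  have "m \<le> k ^ m"
    using k by (simp add: less_imp_le power_gt_expt)
  then have "1 * (3/2::real) ^ m \<le> (real m + 6) * (3/2) ^ (k ^ m)"
    by (intro mult_mono power_increasing) auto
  also have "\<dots> \<le> goebel_real k l n"
    using goebel_real_ge_double_exp n by simp
  finally show ?thesis by (simp add: n power_add)
qed

section \<open>The error term and the logarithmic recursion\<close>

lemma goebel_err_nonneg: "n \<ge> 1 \<Longrightarrow> goebel_err k l n \<ge> 0"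
  using goebel_real_pos[of n] by (simp add: goebel_err_def)

lemma goebel_err_le:
  obtains K where "K > 0" "\<And>n. n \<ge> 1 \<Longrightarrow> goebel_err k l n \<le> K / real n ^ R"
proof -
  \<comment> \<open>The extra power of n pays for the numerator in n / g^(k-1), which bounds the
    error by ln (1 + x) <= x.\<close>
  obtain K :: real where K: "K > 0" "\<And>n. real n ^ Suc R \<le> K * (3/2) ^ n"
    using power_le_exponential[of "Suc R"] by blast
  have "goebel_err k l n \<le> K * (3/2) ^ 4 / real n ^ R" if n: "n \<ge> 1" for n
  proof -
    have "goebel_real k l n ^ 1 \<le> goebel_real k l n ^ (k - 1)"
      using goebel_real_ge[OF n] k by (intro power_increasing) auto
    then have "(3/2) ^ n / (3/2) ^ 4 \<le> goebel_real k l n ^ (k - 1)"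
      using goebel_real_ge_exp[OF n] by simp
    then have "real n / goebel_real k l n ^ (k - 1) \<le> real n / ((3/2) ^ n / (3/2) ^ 4)"
      by (intro frac_le) auto
    moreover have "goebel_err k l n \<le> real n / goebel_real k l n ^ (k - 1)"
      unfolding goebel_err_def using goebel_real_pos[OF n] by (intro ln_add_one_self_le_self) auto
    moreover have "real n / ((3/2) ^ n / (3/2) ^ 4) \<le> K * (3/2) ^ 4 / real n ^ R"
      using K(2)[of n] n by (simp add: field_simps)
    ultimately show ?thesis by linarith
  qed
  then show thesis
    using K(1) by (intro that[of "K * (3/2) ^ 4"]) auto
qed

lemma ln_goebel_real_Suc:
  assumes n: "n \<ge> 1"
  shows "ln (goebel_real k l (Suc n)) = real k * ln (goebel_real k l n) - ln (real (Suc n)) + goebel_err k l n"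
proof -
  let ?g = "goebel_real k l n"
  have g: "?g > 0" by (rule goebel_real_pos[OF n])
  have "?g * (real n + ?g ^ (k - 1)) = ?g * ?g ^ (k - 1) * (1 + real n / ?g ^ (k - 1))"
    using g by (simp add: field_simps)
  also have "?g * ?g ^ (k - 1) = ?g ^ k"
    using k by (simp flip: power_Suc)
  finally have "goebel_real k l (Suc n) = ?g ^ k * (1 + real n / ?g ^ (k - 1)) / real (Suc n)"
    by (simp add: goebel_real_Suc[OF n])
  moreover have "1 + real n / ?g ^ (k - 1) > 0"
    using g by (intro add_pos_nonneg) auto
  ultimately show ?thesis
    using g by (simp add: ln_div ln_mult ln_realpow goebel_err_def del: of_nat_Suc)
qed

lemma scaled_ln_goebel_diff:
  assumes "n \<ge> 1"
  shows "ln (goebel_real k l (Suc n)) / real k ^ Suc n - ln (goebel_real k l n) / real k ^ n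
    = (goebel_err k l n - ln (real (Suc n))) / real k ^ Suc n"
  using k by (simp add: ln_goebel_real_Suc[OF assms] field_simps del: of_nat_Suc)

section \<open>The growth constant and the expansion of the logarithm\<close>

text \<open>The increments are bounded by (K + n + 1) / k^(n+1), hence summable, and telescope.
  Positivity of \<open>L\<close> is what makes the later constant \<open>exp L\<close> exceed
  1.\<close>

lemma scaled_ln_goebel_limit:
  obtains L where "L > 0" "(\<lambda>n. ln (goebel_real k l n) / real k ^ n) \<longlonglongrightarrow> L"
proof -
  define y where "y n = ln (goebel_real k l n) / real k ^ n" for n
  obtain K where K: "K > 0" "\<And>n. n \<ge> 1 \<Longrightarrow> goebel_err k l n \<le> K / real n ^ 0"
    using goebel_err_le[of 0] by blast
  have "summable (\<lambda>n. y (Suc n) - y n)"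
  proof (rule summable_comparison_test')
    show "summable (\<lambda>n. K * (real (Suc n) ^ 0 / real k ^ Suc n) + real (Suc n) ^ 1 / real k ^ Suc n)"
      by (intro summable_add summable_mult summable_power_over_exp k)
    fix n :: nat
    assume n: "n \<ge> 1"
    have "ln (real (Suc n)) \<le> real (Suc n)" "ln (real (Suc n)) \<ge> 0"
      using ln_le_minus_one[of "real (Suc n)"] by auto
    moreover have "goebel_err k l n \<le> K"
      using K(2)[OF n] by simp
    ultimately have "\<bar>goebel_err k l n - ln (real (Suc n))\<bar> \<le> K + real (Suc n)"
      using K(1) goebel_err_nonneg[OF n] by linarith
    then have "\<bar>goebel_err k l n - ln (real (Suc n))\<bar> / real k ^ Suc n \<le> (K + real (Suc n)) / real k ^ Suc n"
      by (intro divide_right_mono) auto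
    then show "norm (y (Suc n) - y n) \<le> K * (real (Suc n) ^ 0 / real k ^ Suc n) + real (Suc n) ^ 1 / real k ^ Suc n"
      unfolding y_def scaled_ln_goebel_diff[OF n]
      by (simp add: add_divide_distrib del: of_nat_Suc power_Suc)
  qed
  then have "(\<lambda>n. \<Sum>i<n. y (Suc i) - y i) \<longlonglongrightarrow> (\<Sum>n. y (Suc n) - y n)"
    by (rule summable_LIMSEQ)
  \<comment> \<open>\<open>y 0\<close> comes from the dummy value of the sequence at 0; it
    cancels.\<close>
  then have "(\<lambda>n. (y n - y 0) + y 0) \<longlonglongrightarrow> (\<Sum>n. y (Suc n) - y n) + y 0"
    unfolding sum_lessThan_telescope by (intro tendsto_intros)
  then obtain L where L: "y \<longlonglongrightarrow> L" by auto
  \<comment> \<open>Here the double exponential is essential: its exponent k^m cancels against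
    k^(m+4) and leaves a positive constant, whereas a plain exponential bound would only give L >=
    0.\<close>
  have "y (m + 4) \<ge> ln (3/2) / real k ^ 4" for m
  proof -
    have "1 * (3/2) ^ (k ^ m) \<le> (real m + 6) * (3/2) ^ (k ^ m)"
      by (intro mult_right_mono) auto
    also have "\<dots> \<le> goebel_real k l (m + 4)"
      by (rule goebel_real_ge_double_exp)
    finally have "ln ((3/2) ^ (k ^ m)) \<le> ln (goebel_real k l (m + 4))"
      using goebel_real_pos[of "m + 4"] by (subst ln_le_cancel_iff) auto
    then have "real k ^ m * ln (3/2) \<le> ln (goebel_real k l (m + 4))"
      by (simp add: ln_realpow)
    then show ?thesis
      using k by (simp add: y_def power_add field_simps)
  qed
  then have "ln (3/2) / real k ^ 4 \<le> L"
    using LIMSEQ_ignore_initial_segment[OF L, of 4] by (intro LIMSEQ_le_const) auto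
  moreover have "ln (3/2) / real k ^ 4 > 0"
    using k by simp
  ultimately have "L > 0" by linarith
  then show thesis
    using that L unfolding y_def by blast
qed

text \<open>The tail of the telescoping series from n on is multiplied by -k^n, and ln n times the
  geometric series is subtracted. Termwise, ln (n + j + 1) - ln n becomes the logarithm
  shown.\<close>

lemma goebel_log_remainder_sums:
  assumes L: "(\<lambda>n. ln (goebel_real k l n) / real k ^ n) \<longlonglongrightarrow> L" and n: "n \<ge> 1"
  shows "(\<lambda>j. (ln (1 + real (Suc j) / real n) - goebel_err k l (n + j)) / real k ^ Suc j)
    sums (ln (goebel_real k l n) - real k ^ n * L - ln (real n) / (real k - 1))"
proof -
  define y where "y n = ln (goebel_real k l n) / real k ^ n" for n
  have "(\<lambda>j. y (n + j)) \<longlonglongrightarrow> L"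
    using LIMSEQ_ignore_initial_segment[OF L, of n] by (simp add: y_def add.commute)
  then have tele: "(\<lambda>j. y (n + Suc j) - y (n + j)) sums (L - y (n + 0))"
    by (rule telescope_sums)
  have "(\<lambda>j. - (real k ^ n) * (y (n + Suc j) - y (n + j)) - ln (real n) * (1 / real k ^ Suc j))
      sums (- (real k ^ n) * (L - y (n + 0)) - ln (real n) * (1 / (real k - 1)))"
    by (rule sums_diff[OF sums_mult[OF tele] sums_mult[OF sums_inverse_powers[OF k]]])
  moreover have "- (real k ^ n) * (y (n + Suc j) - y (n + j)) - ln (real n) * (1 / real k ^ Suc j)
      = (ln (1 + real (Suc j) / real n) - goebel_err k l (n + j)) / real k ^ Suc j" for j
  proof -
    have "1 + real (Suc j) / real n = real (Suc (n + j)) / real n"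
      using n by (simp add: field_simps)
    then have 1: "ln (1 + real (Suc j) / real n) = ln (real (Suc (n + j))) - ln (real n)"
      using n by (simp add: ln_div del: of_nat_Suc)
    have "y (n + Suc j) - y (n + j) = (goebel_err k l (n + j) - ln (real (Suc (n + j)))) / real k ^ Suc (n + j)"
      using scaled_ln_goebel_diff[of "n + j"] n by (simp add: y_def del: of_nat_Suc power_Suc)
    also have "real k ^ Suc (n + j) = real k ^ n * real k ^ Suc j"
      by (simp add: power_add)
    finally show ?thesis
      unfolding 1 using k by (simp add: field_simps del: of_nat_Suc power_Suc)
  qed
  moreover have "- (real k ^ n) * (L - y (n + 0)) - ln (real n) * (1 / (real k - 1))
      = ln (goebel_real k l n) - real k ^ n * L - ln (real n) / (real k - 1)"
    using k by (simp add: y_def field_simps)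
  ultimately show ?thesis by simp
qed

text \<open>Each logarithm is expanded to order \<open>R\<close>. Summed over j with weights
  k^-(j+1), the polynomial parts give the coefficients, and the remainders stay O(n^-(R+1)) because
  the weights dominate (j+1)^(R+1).\<close>

lemma goebel_log_expansion:
  assumes L: "(\<lambda>n. ln (goebel_real k l n) / real k ^ n) \<longlonglongrightarrow> L"
  shows "has_asymp_expansion
    (\<lambda>n. ln (goebel_real k l n) - real k ^ n * L - ln (real n) / (real k - 1)) (goebel_coeffs k)"
    (is "has_asymp_expansion ?T _")
proof (rule has_asymp_expansionI)
  fix R
  obtain K where K: "K > 0" "\<And>n. n \<ge> 1 \<Longrightarrow> goebel_err k l n \<le> K / real n ^ Suc R"
    using goebel_err_le[of "Suc R"] by blast
  define c where "c r = (-1) ^ Suc r / real r" for r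
  \<comment> \<open>The implied constant: Taylor remainders and error terms summed over all j, free
    of n.\<close>
  define M where "M = (\<Sum>j. real (Suc j) ^ Suc R / real k ^ Suc j + K * (1 / real k ^ Suc j))"
  have M: "(\<lambda>j. real (Suc j) ^ Suc R / real k ^ Suc j + K * (1 / real k ^ Suc j)) sums M"
    unfolding M_def using sums_summable[OF sums_inverse_powers[OF k]]
    by (intro summable_sums summable_add summable_mult summable_power_over_exp k)
  have bound: "\<bar>?T n - (\<Sum>r\<le>R. fps_nth (goebel_coeffs k) r / real n ^ r)\<bar> \<le> M * (1 / real n ^ Suc R)"
    if n: "n \<ge> 1" for n
  proof -
    \<comment> \<open>What is left of the j-th summand once its Taylor polynomial in 1/n is
      removed.\<close>
    define t where "t j = (ln (1 + real (Suc j) / real n) - goebel_err k l (n + j)) / real k ^ Suc j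
        - (\<Sum>r\<le>R. c r / real n ^ r * (real (Suc j) ^ r / real k ^ Suc j))" for j
    have "t sums (?T n - (\<Sum>r\<le>R. c r / real n ^ r * (\<Sum>j. real (Suc j) ^ r / real k ^ Suc j)))"
      unfolding t_def
      by (intro sums_diff sums_sum sums_mult goebel_log_remainder_sums[OF L n] summable_sums
          summable_power_over_exp k)
    then have t: "t sums (?T n - (\<Sum>r\<le>R. fps_nth (goebel_coeffs k) r / real n ^ r))"
      by (simp add: goebel_coeffs_def c_def)
    have term_bound: "\<bar>t j\<bar> \<le> (real (Suc j) ^ Suc R / real k ^ Suc j + K * (1 / real k ^ Suc j)) * (1 / real n ^ Suc R)" for j
    proof -
      have eq: "t j = ((ln (1 + real (Suc j) / real n) - (\<Sum>r\<le>R. c r * (real (Suc j) / real n) ^ r))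
          - goebel_err k l (n + j)) / real k ^ Suc j"
        by (simp add: t_def diff_divide_distrib sum_divide_distrib power_divide del: of_nat_Suc power_Suc)
      have "\<bar>ln (1 + real (Suc j) / real n) - (\<Sum>r\<le>R. c r * (real (Suc j) / real n) ^ r)\<bar>
          \<le> (real (Suc j) / real n) ^ Suc R"
        unfolding c_def by (intro ln_taylor_bound) auto
      \<comment> \<open>The bound at n + j is relaxed to one at n, uniform in j.\<close>
      moreover have "goebel_err k l (n + j) \<le> K / real n ^ Suc R"
      proof -
        have "goebel_err k l (n + j) \<le> K / real (n + j) ^ Suc R"
          using n by (intro K(2)) simp
        also have "\<dots> \<le> K / real n ^ Suc R"
          using n K(1) by (intro divide_left_mono power_mono mult_pos_pos zero_less_power) auto
        finally show ?thesis .
      qed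
      moreover have "goebel_err k l (n + j) \<ge> 0"
        using n by (intro goebel_err_nonneg) auto
      ultimately have "\<bar>(ln (1 + real (Suc j) / real n) - (\<Sum>r\<le>R. c r * (real (Suc j) / real n) ^ r))
          - goebel_err k l (n + j)\<bar> \<le> (real (Suc j) / real n) ^ Suc R + K / real n ^ Suc R"
        by linarith
      then have "\<bar>t j\<bar> \<le> ((real (Suc j) / real n) ^ Suc R + K / real n ^ Suc R) / real k ^ Suc j"
        unfolding eq abs_divide by (simp add: divide_right_mono del: of_nat_Suc power_Suc)
      also have "\<dots> = (real (Suc j) ^ Suc R / real k ^ Suc j + K * (1 / real k ^ Suc j)) * (1 / real n ^ Suc R)"
        by (simp add: power_divide add_divide_distrib distrib_right mult.commute del: of_nat_Suc power_Suc)
      finally show ?thesis .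
    qed
    note major = sums_mult2[OF M, of "1 / real n ^ Suc R"]
    have "norm (suminf t) \<le> (\<Sum>j. (real (Suc j) ^ Suc R / real k ^ Suc j + K * (1 / real k ^ Suc j)) * (1 / real n ^ Suc R))"
      by (rule norm_suminf_le[OF _ sums_summable[OF major]]) (unfold real_norm_def, rule term_bound)
    then show ?thesis
      by (simp only: sums_unique[OF t, symmetric] sums_unique[OF major, symmetric] real_norm_def)
  qed
  show "(\<lambda>n. ?T n - (\<Sum>r\<le>R. fps_nth (goebel_coeffs k) r / real n ^ r)) \<in> O(\<lambda>n. 1 / real n ^ Suc R)"
  proof (rule bigoI)
    show "eventually (\<lambda>n. norm (?T n - (\<Sum>r\<le>R. fps_nth (goebel_coeffs k) r / real n ^ r))
        \<le> M * norm (1 / real n ^ Suc R)) sequentially"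
      using eventually_ge_at_top[of 1]
      by eventually_elim (use bound in \<open>simp del: power_Suc\<close>)
  qed
qed

end

section \<open>Exponentiation and the final expansion\<close>

theorem theorem1p4:
  fixes k :: nat
  assumes "k \<ge> 2"
  shows "\<exists>a :: nat \<Rightarrow> real. \<forall>l :: nat. l \<ge> 2 \<longrightarrow> (\<exists>C :: real. C > 1 \<and> (\<forall>R :: nat.
    (\<lambda>n :: nat. of_rat (goebel k l n)
        - C ^ (k ^ n) * real n powr (1 / (real k - 1)) * (1 + (\<Sum>r = 1..R. a r / real n ^ r)))
      \<in> O(\<lambda>n. C ^ (k ^ n) * real n powr (1 / (real k - 1)) * real n powr (- (real R + 1)))))"
proof -
  \<comment> \<open>Fixed before \<open>l\<close> is introduced, so the coefficients depend on
    \<open>k\<close> alone.\<close>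
  define A where "A = fps_exp 1 oo goebel_coeffs k"
  have A0: "fps_nth A 0 = 1"
    by (simp add: A_def)
  have main: "\<exists>C :: real. C > 1 \<and> (\<forall>R :: nat.
    (\<lambda>n :: nat. of_rat (goebel k l n)
        - C ^ (k ^ n) * real n powr (1 / (real k - 1)) * (1 + (\<Sum>r = 1..R. fps_nth A r / real n ^ r)))
      \<in> O(\<lambda>n. C ^ (k ^ n) * real n powr (1 / (real k - 1)) * real n powr (- (real R + 1))))"
    if l: "l \<ge> 2" for l
  proof -
    obtain L where L: "L > 0" "(\<lambda>n. ln (goebel_real k l n) / real k ^ n) \<longlonglongrightarrow> L"
      using scaled_ln_goebel_limit[OF assms l] by blast
    define T where "T n = ln (goebel_real k l n) - real k ^ n * L - ln (real n) / (real k - 1)" for n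
    define W where "W n = exp L ^ (k ^ n) * real n powr (1 / (real k - 1))" for n
    have "has_asymp_expansion T (goebel_coeffs k)"
      unfolding T_def by (rule goebel_log_expansion[OF assms l L(2)])
    then have T: "has_asymp_expansion (\<lambda>n. exp (T n)) A"
      unfolding A_def by (rule has_asymp_expansion_exp) (simp add: goebel_coeffs_def)
    \<comment> \<open>An exact identity, so the expansion of \<open>exp (T n)\<close> only has to be
      multiplied by the leading factor \<open>W n\<close>.\<close>
    have g: "goebel_real k l n = W n * exp (T n)" if n: "n \<ge> 1" for n
    proof -
      have "goebel_real k l n = exp (real (k ^ n) * L + ln (real n) * (1 / (real k - 1)) + T n)"
        using goebel_real_pos[OF assms l n] by (simp add: T_def)
      then show ?thesis
        using n by (simp add: W_def exp_add powr_def exp_of_nat_mult exp_of_nat2_mult mult.commute del: of_nat_power)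
    qed
    have "(\<lambda>n. of_rat (goebel k l n) - W n * (1 + (\<Sum>r = 1..R. fps_nth A r / real n ^ r)))
      \<in> O(\<lambda>n. W n * real n powr (- (real R + 1)))" for R
    proof -
      have "(\<Sum>r\<le>R. fps_nth A r / real n ^ r) = 1 + (\<Sum>r = 1..R. fps_nth A r / real n ^ r)" for n
        by (simp add: A0 atMost_atLeast0 sum.atLeast_Suc_atMost)
      then have "(\<lambda>n. W n * (exp (T n) - (1 + (\<Sum>r = 1..R. fps_nth A r / real n ^ r))))
          \<in> O(\<lambda>n. W n * (1 / real n ^ Suc R))"
        using has_asymp_expansionD[OF T, of R] by (intro landau_o.big.mult) (simp_all del: power_Suc)
      also have "?this \<longleftrightarrow> ?thesis"
      proof (rule landau_o.big.cong_ex)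
        show "eventually (\<lambda>n. W n * (exp (T n) - (1 + (\<Sum>r = 1..R. fps_nth A r / real n ^ r)))
          = of_rat (goebel k l n) - W n * (1 + (\<Sum>r = 1..R. fps_nth A r / real n ^ r))) sequentially"
          using eventually_ge_at_top[of 1]
          by eventually_elim (simp add: g[symmetric] right_diff_distrib flip: goebel_real_def)
        show "eventually (\<lambda>n. W n * (1 / real n ^ Suc R) = W n * real n powr (- (real R + 1))) sequentially"
          using eventually_ge_at_top[of 1]
        proof eventually_elim
          case (elim n)
          then have "real n powr (- real (Suc R)) = 1 / real n ^ Suc R"
            by (simp add: powr_minus powr_realpow divide_inverse del: of_nat_Suc power_Suc)
          then show ?case by (simp add: add.commute)
        qed
      qed
      finally show ?thesis .
    qed
    then show ?thesis
      using L(1) by (intro exI[of _ "exp L"]) (simp add: W_def)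
  qed
  show ?thesis
    by (rule exI[of _ "fps_nth A"]) (use main in blast)
qed

end
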